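(* For every integer $n\ge 2$, $$P^{\mathrm{Clr}}_{D_n}(q,1,-1)=(q^2-1)\,P^{\mathrm{Clr}}_{D_{n-1}}(q,1,-1),$$ and hence, for every $n\ge1$, $P^{\mathrm{Clr}}_{D_n}(q,1,-1)=-(q^2-1)^{n-1}$.
   Context: $B_n=G_{2,n}$ is the set of pairs $\sigma=(z,\tau)$ with $z=(z_1,\dots,z_n)\in\{0,1\}^n$, $\tau\in S_n$ (signed permutations), and $D_n=\{\sigma\in B_n:\sum_i z_i\equiv 0 \pmod 2\}$. Statistics: $\mathrm{csum}(\sigma)=\sum_{i=1}^n z_i$ (as integers); $\mathrm{exc}_A(\sigma)=\#\{i\in[n-1]: z_i=0\text{ and }\tau(i)>i\}$; $\mathrm{cyc}(\sigma)$ = number of cycles of $\tau$; $\mathrm{fix}(\sigma)=\#\{i:\tau(i)=i\}$. Define $\mathrm{exc}^{\mathrm{Clr}}(\sigma)=2\,\mathrm{exc}_A(\sigma)+\mathrm{csum}(\sigma)$ and $P^{\mathrm{Clr}}_{D_n}(q,t,s)=\sum_{\sigma\in D_n}q^{\mathrm{exc}^{\mathrm{Clr}}(\sigma)}t^{\mathrm{fix}(\sigma)}s^{\mathrm{cyc}(\sigma)}$. *)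

theory Defs
  imports "HOL-Combinatorics.Orbits"
begin

type_synonym signed_perm = "(nat \<Rightarrow> nat) \<times> (nat \<Rightarrow> nat)"

text \<open>
  Vectors in \<open>{0,1}\<^sup>n\<close> are extensional functions on \<open>{1..n}\<close> and elements of \<open>S\<^sub>n\<close> are functions
  that are the identity outside \<open>{1..n}\<close>, so every signed permutation has exactly one
  representative.
\<close>

definition B_group :: "nat \<Rightarrow> signed_perm set" where
  "B_group n = ({1..n} \<rightarrow>\<^sub>E {0, 1}) \<times> {\<tau>. \<tau> permutes {1..n}}"

definition csum :: "nat \<Rightarrow> signed_perm \<Rightarrow> nat" where
  "csum n \<sigma> = (\<Sum>i = 1..n. fst \<sigma> i)"

definition D_group :: "nat \<Rightarrow> signed_perm set" where
  "D_group n = {\<sigma> \<in> B_group n. even (csum n \<sigma>)}"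

definition exc_A :: "nat \<Rightarrow> signed_perm \<Rightarrow> nat" where
  "exc_A n \<sigma> = card {i \<in> {1..n - 1}. fst \<sigma> i = 0 \<and> snd \<sigma> i > i}"

definition fix_stat :: "nat \<Rightarrow> signed_perm \<Rightarrow> nat" where
  "fix_stat n \<sigma> = card {i \<in> {1..n}. snd \<sigma> i = i}"

text \<open>The cycles of \<open>\<tau>\<close> are its orbits on \<open>{1..n}\<close>, fixed points being cycles of length one.\<close>

definition cyc :: "nat \<Rightarrow> signed_perm \<Rightarrow> nat" where
  "cyc n \<sigma> = card (orbit (snd \<sigma>) ` {1..n})"

definition exc_Clr :: "nat \<Rightarrow> signed_perm \<Rightarrow> nat" where
  "exc_Clr n \<sigma> = 2 * exc_A n \<sigma> + csum n \<sigma>"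

text \<open>
  The variables range over an arbitrary commutative ring; polynomial identities over the integers
  are the instances where they are indeterminates of a polynomial ring.
\<close>

definition P_Clr_D :: "nat \<Rightarrow> 'a::comm_ring_1 \<Rightarrow> 'a \<Rightarrow> 'a \<Rightarrow> 'a" where
  "P_Clr_D n q t s =
     (\<Sum>\<sigma> \<in> D_group n. q ^ exc_Clr n \<sigma> * t ^ fix_stat n \<sigma> * s ^ cyc n \<sigma>)"

end

theory Submission imports Defs begin

text \<open>
  Fix \<open>z\<close> and sum over \<open>\<tau>\<close> with \<open>s = -1\<close>. Right multiplication of \<open>\<tau>\<close> by a transposition \<open>(a b)\<close>
  changes the parity of the number of cycles. If \<open>z\<^sub>a = z\<^sub>b = 1\<close> for two indices \<open>a \<noteq> b\<close>, it
  preserves \<open>exc\<^sub>A\<close>, so everything cancels; as \<open>csum\<close> is even on \<open>D\<^sub>n\<close>, only \<open>z = 0\<close> survives.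
  For \<open>z = 0\<close> use the transposition \<open>(n-1 n)\<close>: it preserves \<open>exc\<^sub>A\<close> unless \<open>\<tau>(n) = n\<close> or
  \<open>\<tau>(n-1) = n\<close>. The first family is \<open>S\<^sub>n\<^sub>-\<^sub>1\<close> with one extra cycle and contributes the factor \<open>-1\<close>;
  the second is its image under the transposition, has one more excedance, and contributes \<open>q\<^sup>2\<close>.
\<close>

section \<open>Parity of the number of cycles\<close>

lemma orbit_eq_if_mem:
  assumes "permutation p" "y \<in> orbit p x"
  shows "orbit p y = orbit p x"
  using assms by (blast intro: orbit_trans orbit_swap permutation_self_in_orbit)

text \<open>Composing with the transposition makes \<open>p\<close> skip \<open>a\<close>: the
  predecessor of \<open>a\<close> goes straight to \<open>p a\<close>, and \<open>a\<close> becomes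
  fixed.\<close>

lemma orbit_delete_point:
  assumes "inj p" "p a \<noteq> a" "x \<noteq> a"
  shows "orbit (transpose a (p a) \<circ> p) x = orbit p x - {a}"
proof -
  let ?r = "transpose a (p a) \<circ> p"
  have r: "?r y = (if p y = a then p a else p y)" if "y \<noteq> a" for y
    using that assms(1) by (auto simp: transpose_def dest: injD)
  have r_ne: "?r y \<noteq> a" if "y \<noteq> a" for y
    using r[OF that] assms(2) by auto
  have sub: "y \<in> orbit p x \<and> y \<noteq> a" if "y \<in> orbit ?r x" for y
    using that
  proof induction
    case base
    show ?case
      using r[OF assms(3)] r_ne[OF assms(3)] orbit.base[of p x] orbit.step[of "p x" p x]
      by (auto split: if_splits)
  next
    case (step y)
    then show ?case
      using r[of y] r_ne[of y] orbit.step[of y p x] orbit.step[of "p y" p x]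
      by (auto split: if_splits)
  qed
  \<comment> \<open>An orbit of \<open>p\<close> may pass through \<open>a\<close>, which
    \<open>?r\<close> never reaches from \<open>x\<close>; replacing \<open>a\<close> by its
    successor \<open>p a\<close> keeps the induction going.\<close>
  have sup: "(if y = a then p a else y) \<in> orbit ?r x" if "y \<in> orbit p x" for y
    using that
  proof induction
    case base
    show ?case
      using r[OF assms(3)] orbit.base[of ?r x] by metis
  next
    case (step y)
    show ?case
    proof (cases "y = a")
      case True
      then show ?thesis using step assms(2) by auto
    next
      case False
      then show ?thesis using step r[OF False] orbit.step[of y ?r x] by metis
    qed
  qed
  show ?thesis
  proof (intro equalityI subsetI)
    fix y assume "y \<in> orbit p x - {a}"
    then show "y \<in> orbit ?r x" using sup[of y] by auto
  qed (use sub in blast)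
qed

text \<open>Remove a point \<open>a\<close>. If it is fixed, one cycle disappears and the sign is
  unchanged; otherwise \<open>a\<close> is cut out of its cycle, which keeps the number of cycles
  and flips the sign.\<close>

lemma neg_one_power_card_orbits:
  assumes "finite A" "p permutes A"
  shows "(-1::int) ^ card (orbit p ` A) = (-1) ^ card A * sign p"
  using assms
proof (induction A arbitrary: p rule: finite_induct)
  case empty
  then show ?case by simp
next
  case (insert a A)
  have perm: "permutation p"
    using insert by (intro permutes_imp_permutation[of "insert a A"]) auto
  show ?case
  proof (cases "p a = a")
    case True
    have pA: "p permutes A"
      using permutes_insert_lemma[OF insert.prems] True by simp
    have oa: "orbit p a = {a}"
      using True by (simp add: orbit_eq_singleton_iff)
    have "orbit p a \<notin> orbit p ` A"
    proof
      assume "orbit p a \<in> orbit p ` A"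
      then obtain x where "x \<in> A" "orbit p x = {a}" using oa by auto
      then show False
        using permutation_self_in_orbit[OF perm, of x] insert.hyps by auto
    qed
    then have "card (orbit p ` insert a A) = Suc (card (orbit p ` A))"
      using insert.hyps by simp
    then show ?thesis
      using insert.IH[OF pA] insert.hyps by simp
  next
    case False
    let ?r = "transpose a (p a) \<circ> p"
    have rA: "?r permutes A"
      by (rule permutes_insert_lemma[OF insert.prems])
    have paA: "p a \<in> A"
      using permutes_in_image[OF insert.prems, of a] False by auto
    have "orbit p (p a) = orbit p a"
      by (intro orbit_eq_if_mem perm orbit.base)
    then have img: "orbit p ` insert a A = orbit p ` A"
      using paA by (metis image_insert insert_absorb image_eqI)
    \<comment> \<open>Each orbit here contains a point of \<open>A\<close>, which survives the
      deletion of \<open>a\<close> and determines the orbit.\<close>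
    have "inj_on (\<lambda>S. S - {a}) (orbit p ` A)"
    proof (rule inj_onI)
      fix S T assume "S \<in> orbit p ` A" "T \<in> orbit p ` A" and eq: "S - {a} = T - {a}"
      then obtain x y where x: "x \<in> A" "S = orbit p x" and y: "T = orbit p y" by auto
      have "x \<in> orbit p y"
        using eq x y permutation_self_in_orbit[OF perm, of x] insert.hyps by blast
      then show "S = T"
        using orbit_eq_if_mem[OF perm] x y by simp
    qed
    moreover have "(\<lambda>S. S - {a}) ` orbit p ` A = orbit ?r ` A"
      unfolding image_image
    proof (rule image_cong[OF refl])
      fix x assume "x \<in> A"
      then show "orbit p x - {a} = orbit ?r x"
        using insert.hyps orbit_delete_point[OF permutes_inj[OF insert.prems] False, of x] by metis
    qed
    ultimately have "card (orbit p ` insert a A) = card (orbit ?r ` A)"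
      using img card_image by metis
    moreover have "sign ?r = - sign p"
      using perm False by (simp add: sign_compose permutation_swap_id sign_swap_id)
    ultimately show ?thesis
      using insert.IH[OF rA] insert.hyps by (simp del: image_insert add: comp_def)
  qed
qed

lemma neg_one_power_cyc:
  assumes "\<tau> permutes {1..n}"
  shows "(-1 :: 'a::comm_ring_1) ^ cyc n (z, \<tau>) = (-1) ^ n * of_int (sign \<tau>)"
proof -
  have "(-1::int) ^ cyc n (z, \<tau>) = (-1) ^ n * sign \<tau>"
    using neg_one_power_card_orbits[OF _ assms] by (simp add: cyc_def)
  then have "of_int ((-1::int) ^ cyc n (z, \<tau>)) = (of_int ((-1) ^ n * sign \<tau>) :: 'a)"
    by simp
  then show ?thesis by simp
qed

lemma neg_one_power_cyc_transpose:
  assumes "\<tau> permutes {1..n}" "a \<in> {1..n}" "b \<in> {1..n}" "a \<noteq> b"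
  shows "(-1 :: 'a::comm_ring_1) ^ cyc n (z, \<tau> \<circ> transpose a b) = - ((-1) ^ cyc n (z, \<tau>))"
proof -
  have "\<tau> \<circ> transpose a b permutes {1..n}"
    using assms by (intro permutes_compose permutes_swap_id)
  moreover have "permutation \<tau>"
    using assms by (intro permutes_imp_permutation[of "{1..n}"]) auto
  ultimately show ?thesis
    using assms
    by (simp add: neg_one_power_cyc sign_compose permutation_swap_id sign_swap_id)
qed

section \<open>Cancellation and reduction to the zero vector\<close>

text \<open>
  The permutations with \<open>\<tau> a < \<tau> b\<close> are matched with the others, instead of arguing that the sum
  equals its negative: the ring may have characteristic 2.
\<close>

lemma sum_eq_0_if_transpose_antisymmetric:
  fixes f :: "('a::linorder \<Rightarrow> 'a) \<Rightarrow> 'b::ab_group_add"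
  assumes "finite S" "a \<noteq> b"
    and inj: "\<And>\<tau>. \<tau> \<in> S \<Longrightarrow> inj \<tau>"
    and closed: "\<And>\<tau>. \<tau> \<in> S \<Longrightarrow> \<tau> \<circ> transpose a b \<in> S"
    and anti: "\<And>\<tau>. \<tau> \<in> S \<Longrightarrow> f (\<tau> \<circ> transpose a b) = - f \<tau>"
  shows "sum f S = 0"
proof -
  let ?L = "{\<tau> \<in> S. \<tau> a < \<tau> b}" and ?G = "{\<tau> \<in> S. \<tau> b < \<tau> a}"
  have "\<tau> a \<noteq> \<tau> b" if "\<tau> \<in> S" for \<tau>
    using inj[OF that] assms(2) by (auto dest: injD)
  then have S: "S = ?L \<union> ?G" by (auto simp: neq_iff)
  have "sum f ?G = (\<Sum>\<tau>\<in>?L. - f \<tau>)"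
    by (rule sum.reindex_bij_witness[where i = "\<lambda>\<tau>. \<tau> \<circ> transpose a b"
          and j = "\<lambda>\<tau>. \<tau> \<circ> transpose a b"])
      (use closed anti in \<open>auto simp: comp_assoc\<close>)
  moreover have "sum f S = sum f ?L + sum f ?G"
    by (subst S, rule sum.union_disjoint) (use assms(1) in auto)
  ultimately show ?thesis by (simp add: sum_negf)
qed

text \<open>The inner sum of \<open>P_Clr_D n q 1 (-1)\<close> for a fixed vector \<open>z\<close>;
  the factor \<open>q ^ csum\<close> depends on \<open>z\<close> alone and is left out.\<close>

definition exc_cyc_sum :: "nat \<Rightarrow> 'a::comm_ring_1 \<Rightarrow> (nat \<Rightarrow> nat) \<Rightarrow> 'a" where
  "exc_cyc_sum n q z = (\<Sum>\<tau> | \<tau> permutes {1..n}. q ^ (2 * exc_A n (z, \<tau>)) * (-1) ^ cyc n (z, \<tau>))"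

text \<open>Neither \<open>a\<close> nor \<open>b\<close> is ever counted by \<open>exc_A\<close>,
  so exchanging their images changes only the sign of a term.\<close>

lemma exc_cyc_sum_eq_0:
  fixes q :: "'a::comm_ring_1"
  assumes "a \<in> {1..n}" "b \<in> {1..n}" "a \<noteq> b" "z a \<noteq> 0" "z b \<noteq> 0"
  shows "exc_cyc_sum n q z = 0"
  unfolding exc_cyc_sum_def
proof (rule sum_eq_0_if_transpose_antisymmetric[where a = a and b = b])
  fix \<tau> assume "\<tau> \<in> {\<tau>. \<tau> permutes {1..n}}"
  then have \<tau>: "\<tau> permutes {1..n}" by simp
  show "inj \<tau>" by (rule permutes_inj[OF \<tau>])
  show "\<tau> \<circ> transpose a b \<in> {\<tau>. \<tau> permutes {1..n}}"
    using assms \<tau> by (auto intro!: permutes_compose permutes_swap_id)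
  have "exc_A n (z, \<tau> \<circ> transpose a b) = exc_A n (z, \<tau>)"
    unfolding exc_A_def
    by (rule arg_cong[where f = card]) (use assms in \<open>auto simp: transpose_def\<close>)
  then show "q ^ (2 * exc_A n (z, \<tau> \<circ> transpose a b)) * (-1) ^ cyc n (z, \<tau> \<circ> transpose a b) =
      - (q ^ (2 * exc_A n (z, \<tau>)) * (-1) ^ cyc n (z, \<tau>))"
    using neg_one_power_cyc_transpose[OF \<tau> assms(1-3), where 'a = 'a] by simp
qed (use assms in \<open>auto simp: finite_permutations\<close>)

lemma P_Clr_D_eq_exc_cyc_sum:
  "P_Clr_D n q 1 (-1) = exc_cyc_sum n q (\<lambda>i\<in>{1..n}. 0)"
proof -
  let ?Z = "{z \<in> {1..n} \<rightarrow>\<^sub>E {0, 1::nat}. even (\<Sum>i = 1..n. z i)}"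
  let ?z0 = "\<lambda>i\<in>{1..n}. 0::nat"
  have D: "D_group n = ?Z \<times> {\<tau>. \<tau> permutes {1..n}}"
    by (auto simp: D_group_def B_group_def csum_def)
  have fin: "finite ?Z"
    by (rule finite_subset[OF _ finite_PiE[of "{1..n}" "\<lambda>_. {0, 1}"]]) auto
  have z0: "?z0 \<in> ?Z" by auto
  have van: "exc_cyc_sum n q z = 0" if z: "z \<in> ?Z - {?z0}" for z
  proof -
    have "\<exists>a\<in>{1..n}. z a \<noteq> 0"
    proof (rule ccontr)
      assume "\<not> ?thesis"
      then have "z = ?z0"
        using z by (intro extensionalityI[of z "{1..n}"]) (auto simp: PiE_def)
      then show False using z by simp
    qed
    then obtain a where a: "a \<in> {1..n}" "z a \<noteq> 0" by blast
    then have "z a = 1" using z by (auto simp: PiE_def Pi_def)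
    moreover have "sum z {1..n} = z a + sum z ({1..n} - {a})"
      using a by (intro sum.remove) auto
    \<comment> \<open>The total is even and \<open>z a = 1\<close>, so the other entries have odd
      sum and cannot all vanish.\<close>
    ultimately have "odd (sum z ({1..n} - {a}))"
      using z by simp
    then obtain b where "b \<in> {1..n} - {a}" "z b \<noteq> 0"
      by (metis even_zero sum.neutral)
    then show ?thesis
      using a by (intro exc_cyc_sum_eq_0[of a n b]) auto
  qed
  have "P_Clr_D n q 1 (-1) = (\<Sum>z\<in>?Z. q ^ (\<Sum>i = 1..n. z i) * exc_cyc_sum n q z)"
    unfolding P_Clr_D_def D exc_cyc_sum_def sum_distrib_left
    by (subst sum.cartesian_product)
      (auto intro!: sum.cong simp: exc_Clr_def csum_def power_add mult_ac)
  also have "\<dots> = q ^ (\<Sum>i = 1..n. ?z0 i) * exc_cyc_sum n q ?z0"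
    using van by (subst sum.remove[OF fin z0]) (simp add: sum.neutral)
  finally show ?thesis by simp
qed

section \<open>The recurrence\<close>

lemma P_Clr_D_Suc:
  fixes q :: "'a::comm_ring_1"
  assumes "m \<ge> 1"
  shows "P_Clr_D (Suc m) q 1 (-1) = (q\<^sup>2 - 1) * P_Clr_D m q 1 (-1)"
proof -
  let ?n = "Suc m"
  let ?t = "transpose m ?n"
  let ?z = "\<lambda>k. \<lambda>i\<in>{1..k}. 0::nat"
  let ?w = "\<lambda>k \<tau>. q ^ (2 * exc_A k (?z k, \<tau>)) * (-1) ^ cyc k (?z k, \<tau>)"
  let ?S = "{\<tau>. \<tau> permutes {1..?n}}" and ?T = "{\<tau>. \<tau> permutes {1..m}}"
  \<comment> \<open>The classes record where the value \<open>?n\<close> is taken: at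
    \<open>?n\<close>, at \<open>m\<close>, or elsewhere.\<close>
  let ?A = "{\<tau> \<in> ?S. \<tau> ?n = ?n}" and ?B = "{\<tau> \<in> ?S. \<tau> m = ?n}"
    and ?C = "{\<tau> \<in> ?S. \<tau> ?n \<noteq> ?n \<and> \<tau> m \<noteq> ?n}"
  have exc: "exc_A k (?z k, \<tau>) = card {i \<in> {1..k - 1}. i < \<tau> i}" for k \<tau>
    unfolding exc_A_def by (rule arg_cong[where f = card]) auto
  have le: "\<tau> i \<le> k" if "\<tau> permutes {1..k}" "i \<in> {1..k}" for \<tau> and i k :: nat
    using permutes_in_image[OF that(1), of i] that(2) by simp
  have t_perm: "\<tau> \<circ> ?t permutes {1..?n}" if "\<tau> permutes {1..?n}" for \<tau>
    using that assms by (intro permutes_compose permutes_swap_id) auto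
  have fin: "finite ?S" by (simp add: finite_permutations)
  have A: "?A = ?T"
  proof (intro equalityI subsetI)
    fix \<tau> assume "\<tau> \<in> ?A"
    then have "\<tau> permutes {1..?n}" and "\<tau> x = x" if "x \<in> {1..?n} - {1..m}" for x
      using that by (auto simp: le_Suc_eq)
    then show "\<tau> \<in> ?T"
      using permutes_superset[of \<tau> "{1..?n}" "{1..m}"] \<open>\<tau> \<in> ?A\<close> by blast
  next
    fix \<tau> assume "\<tau> \<in> ?T"
    then show "\<tau> \<in> ?A"
      using permutes_subset[of \<tau> "{1..m}" "{1..?n}"] permutes_not_in[of \<tau> "{1..m}" ?n] by simp
  qed
  have excA: "exc_A ?n (?z ?n, \<tau>) = exc_A m (?z m, \<tau>)" if \<tau>: "\<tau> \<in> ?T" for \<tau>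
    unfolding exc
  proof (rule arg_cong[where f = card])
    \<comment> \<open>Passing from \<open>m\<close> to \<open>?n\<close> adds only the index
      \<open>m\<close> to the range of \<open>exc_A\<close>, and \<open>m\<close> is no excedance
      because \<tau> maps it into \<open>{1..m}\<close>.\<close>
    have "i \<noteq> m" if "i < \<tau> i" for i
      using le[of \<tau> m m] \<tau> assms that by auto
    then show "{i \<in> {1..?n - 1}. i < \<tau> i} = {i \<in> {1..m - 1}. i < \<tau> i}"
      by fastforce
  qed
  have wA: "?w ?n \<tau> = - ?w m \<tau>" if \<tau>: "\<tau> \<in> ?T" for \<tau>
  proof -
    have "\<tau> permutes {1..?n}" using \<tau> A by blast
    then show ?thesis
      using \<tau> excA[OF \<tau>] by (simp add: neg_one_power_cyc)
  qed
  have wB: "?w ?n (\<tau> \<circ> ?t) = q\<^sup>2 * ?w m \<tau>" if \<tau>: "\<tau> \<in> ?T" for \<tau>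
  proof -
    have \<tau>n: "\<tau> permutes {1..?n}" "\<tau> ?n = ?n" using \<tau> A by blast+
    have m: "\<not> m < \<tau> m" using le[of \<tau> m m] \<tau> assms by auto
    \<comment> \<open>The composite sends \<open>m\<close> to \<open>?n\<close>, a new excedance;
      its value at \<open>?n\<close> is irrelevant, as that index is outside the range.\<close>
    have "{i \<in> {1..?n - 1}. i < (\<tau> \<circ> ?t) i} = insert m {i \<in> {1..?n - 1}. i < \<tau> i}"
      using assms \<tau>n by (auto simp: transpose_def)
    then have "exc_A ?n (?z ?n, \<tau> \<circ> ?t) = Suc (exc_A ?n (?z ?n, \<tau>))"
      unfolding exc using m by simp
    moreover have "(-1 :: 'a) ^ cyc ?n (?z ?n, \<tau> \<circ> ?t) = - ((-1) ^ cyc ?n (?z ?n, \<tau>))"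
      by (rule neg_one_power_cyc_transpose[OF \<tau>n(1)]) (use assms in auto)
    \<comment> \<open>This minus sign, from the transposition, cancels the one in
      \<open>wA\<close>.\<close>
    ultimately have "?w ?n (\<tau> \<circ> ?t) = q\<^sup>2 * - ?w ?n \<tau>"
      by (simp add: power2_eq_square mult_ac)
    then show ?thesis using wA[OF \<tau>] by simp
  qed
  have sA: "sum (?w ?n) ?A = - sum (?w m) ?T"
    unfolding A using wA by (simp add: sum_negf)
  \<comment> \<open>Composition with \<open>?t\<close> is an involution that exchanges
    \<open>?A\<close> and \<open>?B\<close>.\<close>
  have "sum (?w ?n) ?B = (\<Sum>\<tau>\<in>?A. ?w ?n (\<tau> \<circ> ?t))"
    by (rule sum.reindex_bij_witness[where i = "\<lambda>\<tau>. \<tau> \<circ> ?t" and j = "\<lambda>\<tau>. \<tau> \<circ> ?t"])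
      (use t_perm in \<open>auto simp: comp_assoc\<close>)
  then have sB: "sum (?w ?n) ?B = q\<^sup>2 * sum (?w m) ?T"
    unfolding A sum_distrib_left using wB by simp
  have sC: "sum (?w ?n) ?C = 0"
  proof (rule sum_eq_0_if_transpose_antisymmetric[where a = m and b = ?n])
    fix \<tau> assume C: "\<tau> \<in> ?C"
    then have \<tau>: "\<tau> permutes {1..?n}" by simp
    show "inj \<tau>" by (rule permutes_inj[OF \<tau>])
    show "\<tau> \<circ> ?t \<in> ?C" using C t_perm by auto
    \<comment> \<open>With both images at most \<open>m\<close>, the index \<open>m\<close> is an
      excedance neither before nor after the exchange.\<close>
    have "\<tau> m \<le> m" "\<tau> ?n \<le> m"
      using le[OF \<tau>, of m] le[OF \<tau>, of ?n] C assms by auto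
    then have "{i \<in> {1..?n - 1}. i < (\<tau> \<circ> ?t) i} = {i \<in> {1..?n - 1}. i < \<tau> i}"
      by (auto simp: transpose_def)
    then show "?w ?n (\<tau> \<circ> ?t) = - ?w ?n \<tau>"
      using neg_one_power_cyc_transpose[OF \<tau>, of m ?n, where 'a = 'a] assms
      unfolding exc by simp
  qed (use fin in auto)
  have ne: "\<tau> m \<noteq> \<tau> ?n" if "\<tau> \<in> ?S" for \<tau>
    using that permutes_inj[of \<tau> "{1..?n}"] by (simp add: inj_eq)
  have "?A \<inter> ?B = {}"
  proof (rule equals0I)
    fix \<tau> assume "\<tau> \<in> ?A \<inter> ?B"
    then show False using ne[of \<tau>] by simp
  qed
  then have AB: "sum (?w ?n) (?A \<union> ?B) = sum (?w ?n) ?A + sum (?w ?n) ?B"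
    using fin by (intro sum.union_disjoint) simp_all
  have "(?A \<union> ?B) \<inter> ?C = {}" by blast
  then have "sum (?w ?n) ((?A \<union> ?B) \<union> ?C) = sum (?w ?n) (?A \<union> ?B) + sum (?w ?n) ?C"
    using fin by (intro sum.union_disjoint) simp_all
  moreover have "(?A \<union> ?B) \<union> ?C = ?S" by blast
  ultimately have "sum (?w ?n) ?S = sum (?w ?n) ?A + sum (?w ?n) ?B + sum (?w ?n) ?C"
    by (simp only: AB)
  then show ?thesis
    unfolding P_Clr_D_eq_exc_cyc_sum exc_cyc_sum_def sA sB sC by (simp add: algebra_simps)
qed

lemma P_Clr_D_1: "P_Clr_D 1 q 1 (-1) = -1"
proof -
  have "{\<tau>::nat \<Rightarrow> nat. \<tau> permutes {1..1}} = {id}"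
    by (auto simp: permutes_sing)
  then show ?thesis
    by (simp add: P_Clr_D_eq_exc_cyc_sum exc_cyc_sum_def exc_A_def cyc_def)
qed

theorem theorem3:
  fixes q :: "'a::comm_ring_1"
  shows "(\<forall>n::nat. n \<ge> 2 \<longrightarrow> P_Clr_D n q 1 (-1) = (q\<^sup>2 - 1) * P_Clr_D (n - 1) q 1 (-1)) \<and>
         (\<forall>n::nat. n \<ge> 1 \<longrightarrow> P_Clr_D n q 1 (-1) = - ((q\<^sup>2 - 1) ^ (n - 1)))"
proof (intro conjI allI impI)
  fix n :: nat assume "n \<ge> 2"
  then show "P_Clr_D n q 1 (-1) = (q\<^sup>2 - 1) * P_Clr_D (n - 1) q 1 (-1)"
    using P_Clr_D_Suc[of "n - 1" q] by simp
next
  fix n :: nat assume "n \<ge> 1"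
  then show "P_Clr_D n q 1 (-1) = - ((q\<^sup>2 - 1) ^ (n - 1))"
  proof (induction n rule: dec_induct)
    case base
    show ?case using P_Clr_D_1[of q] by simp
  next
    case (step n)
    \<comment> \<open>Subtraction on naturals is truncated; the induction starts at 1, so
      \<open>n\<close> is positive here.\<close>
    then have "(q\<^sup>2 - 1) ^ n = (q\<^sup>2 - 1) * (q\<^sup>2 - 1) ^ (n - 1)"
      by (cases n) auto
    with step show ?case
      using P_Clr_D_Suc[of n q] by simp
  qed
qed

end
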